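(* For every graph $G$, $\alpha'_g(G)-1\le\hat\alpha'_g(G)\le\frac{3}{2}\mu(G)$.
   Context: Graphs are finite and simple. $\mu(G)$ denotes the minimum size of a maximal (with respect to inclusion) matching in $G$. The matching game on a graph $G$: two players, Max and Min, alternately add edges of $G$ to a set of chosen edges that must always remain a matching; the game ends when the chosen edges form a maximal matching of $G$ (no further edge can be added). Max wants the final matching to be large, Min wants it to be small. $\alpha'_g(G)$ denotes the size of the final matching under optimal play when Max moves first, and $\hat\alpha'_g(G)$ denotes the size of the final matching under optimal play when Min moves first. *)

theory Defs
  imports Complex_Main
begin

definition simple_graph :: "'a set \<Rightarrow> 'a set set \<Rightarrow> bool" where
  "simple_graph V E \<longleftrightarrow> finite V \<and> (\<forall>e\<in>E. e \<subseteq> V \<and> card e = 2)"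

text \<open>Matchings, and hence everything below, depend only on the edge set of the graph.\<close>

definition matching :: "'a set set \<Rightarrow> 'a set set \<Rightarrow> bool" where
  "matching E M \<longleftrightarrow> M \<subseteq> E \<and> pairwise disjnt M"

definition maximal_matching :: "'a set set \<Rightarrow> 'a set set \<Rightarrow> bool" where
  "maximal_matching E M \<longleftrightarrow>
     matching E M \<and> (\<forall>M'. matching E M' \<and> M \<subseteq> M' \<longrightarrow> M' = M)"

definition min_maximal_matching :: "'a set set \<Rightarrow> nat" where
  "min_maximal_matching E = Min (card ` {M. maximal_matching E M})"

datatype player = PMax | PMin

definition moves :: "'a set set \<Rightarrow> 'a set set \<Rightarrow> 'a set set" where
  "moves E M = {e \<in> E. e \<notin> M \<and> matching E (insert e M)}"

lemma moves_empty_iff_maximal: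
  assumes "matching E M"
  shows "moves E M = {} \<longleftrightarrow> maximal_matching E M"
proof
  assume no: "moves E M = {}"
  show "maximal_matching E M"
    unfolding maximal_matching_def
  proof (intro conjI allI impI assms)
    fix M' assume M': "matching E M' \<and> M \<subseteq> M'"
    have "x \<in> M" if "x \<in> M'" for x
    proof (rule ccontr)
      assume "x \<notin> M"
      have "insert x M \<subseteq> M'" using M' that by blast
      then have "matching E (insert x M)"
        using M' unfolding matching_def by (meson pairwise_subset subset_trans)
      then have "x \<in> moves E M"
        using \<open>x \<notin> M\<close> by (simp add: moves_def matching_def)
      with no show False by simp
    qed
    with M' show "M' = M" by blast
  qed
next
  assume "maximal_matching E M"
  then show "moves E M = {}"
    unfolding maximal_matching_def moves_def by blast
qed

text \<open>
  The size of the final matching under optimal play (minimax value) when \<open>p\<close> is to move and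
  \<open>M\<close> has been chosen so far.  The test for infinite \<open>E\<close> only serves to make the recursion total.
\<close>

function game_value :: "'a set set \<Rightarrow> player \<Rightarrow> 'a set set \<Rightarrow> nat" where
  "game_value E p M =
     (if infinite E \<or> moves E M = {} then card M
      else case p of
        PMax \<Rightarrow> Max ((\<lambda>e. game_value E PMin (insert e M)) ` moves E M)
      | PMin \<Rightarrow> Min ((\<lambda>e. game_value E PMax (insert e M)) ` moves E M))"
  by pat_completeness auto
termination
  by (relation "measure (\<lambda>(E, p, M). card (E - M))")
     (auto simp del: card_Diff_insert simp: moves_def intro!: psubset_card_mono)

declare game_value.simps [simp del]

definition game_matching_max_first :: "'a set set \<Rightarrow> nat" where
  "game_matching_max_first E = game_value E PMax {}"

definition game_matching_min_first :: "'a set set \<Rightarrow> nat" where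
  "game_matching_min_first E = game_value E PMin {}"

end

theory Submission
  imports Defs
begin

text \<open>
  Playing \<open>e\<close> turns the game on \<open>G\<close> into the game on \<open>G - V(e)\<close>. Deleting vertices never increases
  either game value (induction over both values at once), so the value of Max's first move \<open>e\<close> is
  at most one more than the value of the Min-start game on \<open>G\<close>.

  For the upper bound, Min plays edges of a smallest maximal matching \<open>P\<close> as long as possible, and the
  potential is \<open>2 |T| - |P|\<close>, where \<open>T\<close> consists of the free vertices of the vertex cover \<open>V(P)\<close> and
  \<open>P\<close> of those of its edges that are still playable. Min's moves in \<open>P\<close> lower it by 3 and Max's
  moves by at least 1, so by at least 4 per round; once \<open>P\<close> is used up every move lowers it by at
  least 2.
\<close>

section \<open>Game positions as vertex-deleted graphs\<close>

definition delete_verts :: "'a set set \<Rightarrow> 'a set \<Rightarrow> 'a set set" where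
  "delete_verts F S = {e \<in> F. e \<inter> S = {}}"

lemma in_delete_verts [simp]: "e \<in> delete_verts F S \<longleftrightarrow> e \<in> F \<and> e \<inter> S = {}"
  by (simp add: delete_verts_def)

lemma delete_verts_subset: "delete_verts F S \<subseteq> F"
  by auto

lemma delete_verts_delete_verts [simp]:
  "delete_verts (delete_verts F S) T = delete_verts F (S \<union> T)"
  by auto

lemma finite_delete_verts [simp]: "finite F \<Longrightarrow> finite (delete_verts F S)"
  by (rule finite_subset[OF delete_verts_subset])

lemma card_delete_verts_less:
  assumes "finite F" "e \<in> F" "e \<inter> S \<noteq> {}"
  shows "card (delete_verts F S) < card F"
proof (intro psubset_card_mono psubsetI delete_verts_subset)
  show "delete_verts F S \<noteq> F" using assms(2,3) by (metis in_delete_verts)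
qed (use assms in simp)

text \<open>A nonempty chosen edge meets \<open>\<Union>M\<close>, so avoiding
  \<open>\<Union>M\<close> already forces \<open>e \<notin> M\<close>; an empty edge would break
  this.\<close>

lemma moves_eq_delete_verts:
  assumes "matching E M" "{} \<notin> E"
  shows "moves E M = delete_verts E (\<Union>M)"
proof (intro set_eqI iffI)
  fix e assume "e \<in> moves E M"
  then have "e \<in> E" "e \<notin> M" "pairwise disjnt (insert e M)"
    by (auto simp: moves_def matching_def)
  then show "e \<in> delete_verts E (\<Union>M)"
    by (auto simp: pairwise_insert disjnt_def)
next
  fix e assume e: "e \<in> delete_verts E (\<Union>M)"
  with assms(2) have "e \<noteq> {}" by auto
  with e have "e \<notin> M" by auto
  with e assms(1) show "e \<in> moves E M"
    by (auto simp: moves_def matching_def pairwise_insert disjnt_def)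
qed

text \<open>The chosen edges matter only through their number and the vertices they block, since
  adding the constant \<open>card M\<close> commutes with \<open>Max\<close> and \<open>Min\<close>.
  The graph varies in the induction because \<open>E\<close> and the reduced graph \<open>F\<close>
  are both unfolded by one move.\<close>

lemma game_value_shift:
  assumes "finite E" "{} \<notin> E" "matching E M"
  shows "game_value E p M = card M + game_value (delete_verts E (\<Union>M)) p {}"
  using assms
proof (induction "card (E - M)" arbitrary: E p M rule: less_induct)
  case less
  define F where "F = delete_verts E (\<Union>M)"
  have mvE: "moves E M = F"
    using less.prems by (simp add: F_def moves_eq_delete_verts)
  have mvF: "moves F {} = F"
    using less.prems by (subst moves_eq_delete_verts) (auto simp: F_def matching_def)
  have finM: "finite M"
    using less.prems finite_subset by (auto simp: matching_def)
  show ?case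
  proof (cases "F = {}")
    case True
    then show ?thesis
      using True mvE mvF by (simp add: game_value.simps[of E p M] game_value.simps[of "{}" p "{}"] F_def[symmetric])
  next
    case False
    have finF: "finite F" using less.prems by (simp add: F_def)
    \<comment> \<open>By induction, both positions reduce to the same graph
      \<open>delete_verts F e\<close>, with offsets \<open>card M + 1\<close> and 1.\<close>
    have step: "game_value E q (insert e M) = card M + game_value F q {e}" if e: "e \<in> F" for e q
    proof -
      have eM: "e \<in> E" "e \<notin> M" "matching E (insert e M)"
        using e mvE by (auto simp: moves_def)
      have lessE: "card (E - insert e M) < card (E - M)"
        using eM less.prems by (intro psubset_card_mono) auto
      have "F \<subseteq> E - M"
        using mvE by (auto simp: moves_def)
      then have lessF: "card (F - {e}) < card (E - M)"
        using e less.prems by (intro psubset_card_mono) auto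
      have "game_value E q (insert e M)
          = card (insert e M) + game_value (delete_verts E (\<Union>(insert e M))) q {}"
        using less.hyps[OF lessE] less.prems eM by blast
      also have "delete_verts E (\<Union>(insert e M)) = delete_verts F e"
        by (simp add: F_def Un_commute)
      also have "card (insert e M) = card M + 1"
        using eM finM by simp
      finally have 1: "game_value E q (insert e M) = card M + 1 + game_value (delete_verts F e) q {}" .
      have "matching F {e}" "{} \<notin> F"
        using e less.prems by (auto simp: matching_def F_def)
      then have "game_value F q {e} = card {e} + game_value (delete_verts F (\<Union>{e})) q {}"
        using less.hyps[OF lessF] finF by blast
      with 1 show ?thesis by simp
    qed
    show ?thesis
    proof (cases p)
      case PMax
      have "game_value E p M = Max ((\<lambda>e. game_value F PMin {e} + card M) ` F)"
        using less.prems False mvE step PMax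
        by (simp add: game_value.simps[of E PMax M] add.commute cong: image_cong_simp)
      also have "\<dots> = Max ((\<lambda>e. game_value F PMin {e}) ` F) + card M"
        using finF False by (rule Max_add_commute)
      also have "Max ((\<lambda>e. game_value F PMin {e}) ` F) = game_value F p {}"
        using finF False mvF PMax by (simp add: game_value.simps[of F PMax "{}"])
      finally show ?thesis by (simp add: F_def)
    next
      case PMin
      have "game_value E p M = Min ((\<lambda>e. game_value F PMax {e} + card M) ` F)"
        using less.prems False mvE step PMin
        by (simp add: game_value.simps[of E PMin M] add.commute cong: image_cong_simp)
      also have "\<dots> = Min ((\<lambda>e. game_value F PMax {e}) ` F) + card M"
        using finF False by (rule Min_add_commute)
      also have "Min ((\<lambda>e. game_value F PMax {e}) ` F) = game_value F p {}"
        using finF False mvF PMin by (simp add: game_value.simps[of F PMin "{}"])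
      finally show ?thesis by (simp add: F_def)
    qed
  qed
qed

section \<open>One-move recursion for the two game values\<close>

lemma game_matching_empty [simp]:
  "game_matching_max_first {} = 0" "game_matching_min_first {} = 0"
  by (simp_all add: game_matching_max_first_def game_matching_min_first_def
      game_value.simps[of "{}" PMax "{}"] game_value.simps[of "{}" PMin "{}"] moves_def)

context
  fixes F :: "'a set set"
  assumes F: "finite F" "{} \<notin> F" "F \<noteq> {}"
begin

lemma moves_start: "moves F {} = F"
  using F by (subst moves_eq_delete_verts) (auto simp: matching_def)

lemma game_value_single:
  assumes "e \<in> F"
  shows "game_value F p {e} = Suc (game_value (delete_verts F e) p {})"
  using game_value_shift[of F "{e}" p] assms F by (simp add: matching_def)

lemma game_matching_max_first_rec:
  "game_matching_max_first F = Max ((\<lambda>e. Suc (game_matching_min_first (delete_verts F e))) ` F)"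
  unfolding game_matching_max_first_def game_matching_min_first_def
  using F moves_start game_value_single
  by (simp add: game_value.simps[of F PMax "{}"] cong: image_cong_simp)

lemma game_matching_min_first_rec:
  "game_matching_min_first F = Min ((\<lambda>e. Suc (game_matching_max_first (delete_verts F e))) ` F)"
  unfolding game_matching_max_first_def game_matching_min_first_def
  using F moves_start game_value_single
  by (simp add: game_value.simps[of F PMin "{}"] cong: image_cong_simp)

lemma game_matching_max_first_ge:
  "e \<in> F \<Longrightarrow> Suc (game_matching_min_first (delete_verts F e)) \<le> game_matching_max_first F"
  unfolding game_matching_max_first_rec using F by (intro Max_ge) auto

lemma game_matching_min_first_le:
  "e \<in> F \<Longrightarrow> game_matching_min_first F \<le> Suc (game_matching_max_first (delete_verts F e))"
  unfolding game_matching_min_first_rec using F by (intro Min_le) auto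

lemma game_matching_max_first_attained:
  obtains e where "e \<in> F"
    "game_matching_max_first F = Suc (game_matching_min_first (delete_verts F e))"
proof -
  have "game_matching_max_first F \<in> (\<lambda>e. Suc (game_matching_min_first (delete_verts F e))) ` F"
    unfolding game_matching_max_first_rec using F by (intro Max_in) auto
  with that show ?thesis by blast
qed

lemma game_matching_min_first_attained:
  obtains e where "e \<in> F"
    "game_matching_min_first F = Suc (game_matching_max_first (delete_verts F e))"
proof -
  have "game_matching_min_first F \<in> (\<lambda>e. Suc (game_matching_max_first (delete_verts F e))) ` F"
    unfolding game_matching_min_first_rec using F by (intro Min_in) auto
  with that show ?thesis by blast
qed

end

section \<open>Monotonicity under vertex deletion\<close>

text \<open>
  Min's optimal move \<open>e\<close> in \<open>G\<close> may be unavailable in \<open>G - S\<close>. The reply \<open>f\<close> below is chosen so that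
  \<open>G - S - f\<close> is still obtained from \<open>G - e\<close> by deleting vertices.
\<close>

lemma exists_reply:
  assumes e: "e \<in> F" "card e = 2" and ne: "delete_verts F S \<noteq> {}"
  obtains f where "f \<in> delete_verts F S" "delete_verts F (S \<union> f) = delete_verts F (e \<union> (S \<union> f))"
proof (cases "\<exists>f \<in> delete_verts F S. e \<subseteq> S \<union> f")
  case True
  then obtain f where f: "f \<in> delete_verts F S" "e \<subseteq> S \<union> f" by blast
  then have "S \<union> f = e \<union> (S \<union> f)" by blast
  with f that show ?thesis by simp
next
  case False
  obtain f where f: "f \<in> delete_verts F S" using ne by blast
  \<comment> \<open>Otherwise \<open>e\<close> itself would survive and serve as \<open>f\<close> in
    the first case.\<close>
  have "e \<inter> S \<noteq> {}" using False e by (metis UnCI in_delete_verts subsetI)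
  then obtain v where v: "v \<in> e" "v \<in> S" by blast
  obtain x y where "e = {x, y}" using e(2) by (auto simp: card_2_iff)
  with v obtain w where w: "e = {v, w}" by auto
  \<comment> \<open>A surviving edge through \<open>w\<close> would cover \<open>e\<close> together
    with \<open>S\<close>. So \<open>w\<close> is isolated after deleting \<open>S\<close>, and
    deleting \<open>e\<close> as well removes no further edge.\<close>
  have "g \<inter> e = {}" if "g \<in> delete_verts F S" for g
    using that False v w by auto
  then have "delete_verts F (S \<union> f) = delete_verts F (e \<union> (S \<union> f))"
    by (fastforce simp: Int_Un_distrib)
  with f that show ?thesis by blast
qed

text \<open>Max's best edge in the smaller graph is also available in \<open>F\<close>; Min's best
  edge in \<open>F\<close> is replaced by the reply from \<open>exists_reply\<close>. Either way the
  position reached in the smaller graph is a vertex deletion of the one reached in \<open>F\<close>,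
  with the other player to move.\<close>

lemma game_matching_delete_verts_le:
  assumes "finite F" "\<forall>e\<in>F. card e = 2"
  shows "game_matching_max_first (delete_verts F S) \<le> game_matching_max_first F \<and>
         game_matching_min_first (delete_verts F S) \<le> game_matching_min_first F"
  using assms
proof (induction "card F" arbitrary: F S rule: less_induct)
  case less
  define H where "H = delete_verts F S"
  show ?case
  proof (cases "H = {}")
    case True
    then show ?thesis by (simp add: H_def)
  next
    case False
    have F: "finite F" "{} \<notin> F" "F \<noteq> {}"
      using less.prems False by (auto simp: H_def)
    have H: "finite H" "{} \<notin> H" "H \<noteq> {}"
      using F False by (auto simp: H_def)
    have IH: "game_matching_max_first (delete_verts F (e \<union> T)) \<le> game_matching_max_first (delete_verts F e)"
         "game_matching_min_first (delete_verts F (e \<union> T)) \<le> game_matching_min_first (delete_verts F e)"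
      if "e \<in> F" for e T
    proof -
      have "card (delete_verts F e) < card F"
        using that F by (intro card_delete_verts_less) auto
      from less.hyps[OF this, of T] less.prems
      show "game_matching_max_first (delete_verts F (e \<union> T)) \<le> game_matching_max_first (delete_verts F e)"
         "game_matching_min_first (delete_verts F (e \<union> T)) \<le> game_matching_min_first (delete_verts F e)"
        by auto
    qed
    obtain e where e: "e \<in> H"
      "game_matching_max_first H = Suc (game_matching_min_first (delete_verts H e))"
      using game_matching_max_first_attained[OF H] by blast
    have "e \<in> F" using e by (simp add: H_def)
    have "delete_verts H e = delete_verts F (e \<union> S)"
      by (simp add: H_def Un_commute)
    with e IH(2)[OF \<open>e \<in> F\<close>] game_matching_max_first_ge[OF F \<open>e \<in> F\<close>]
    have A: "game_matching_max_first H \<le> game_matching_max_first F"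
      by (metis Suc_le_mono le_trans)
    obtain e' where e': "e' \<in> F"
      "game_matching_min_first F = Suc (game_matching_max_first (delete_verts F e'))"
      using game_matching_min_first_attained[OF F] by blast
    obtain f where f: "f \<in> H" "delete_verts F (S \<union> f) = delete_verts F (e' \<union> (S \<union> f))"
      using exists_reply[of e' F S] e' less.prems False unfolding H_def by blast
    have "game_matching_min_first H \<le> Suc (game_matching_max_first (delete_verts H f))"
      using game_matching_min_first_le[OF H f(1)] .
    also have "delete_verts H f = delete_verts F (e' \<union> (S \<union> f))"
      using f(2) by (simp add: H_def)
    also have "game_matching_max_first \<dots> \<le> game_matching_max_first (delete_verts F e')"
      by (rule IH(1)[OF e'(1)])
    finally have "game_matching_min_first H \<le> game_matching_min_first F"
      using e'(2) by simp
    with A show ?thesis by (simp add: H_def)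
  qed
qed

lemma game_matching_max_first_le_Suc_min_first:
  assumes "finite F" "\<forall>e\<in>F. card e = 2"
  shows "game_matching_max_first F \<le> Suc (game_matching_min_first F)"
proof (cases "F = {}")
  case False
  have "{} \<notin> F" using assms(2) by auto
  then obtain e where
    "game_matching_max_first F = Suc (game_matching_min_first (delete_verts F e))"
    using game_matching_max_first_attained[OF assms(1) _ False] by blast
  with game_matching_delete_verts_le[OF assms] show ?thesis by simp
qed simp

section \<open>The potential bound relative to a vertex cover\<close>

text \<open>Each edge of \<open>P\<close> destroyed by \<open>e\<close> contains a vertex of
  \<open>T \<inter> e\<close>, and disjoint edges use different vertices.\<close>

lemma card_le_delete_verts_add:
  assumes "finite P" "pairwise disjnt P" "\<Union>P \<subseteq> T" "finite T"
  shows "card P \<le> card (delete_verts P e) + card (T \<inter> e)"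
proof -
  define h where "h p = (SOME x. x \<in> p \<inter> e)" for p
  have h: "h p \<in> p \<inter> e" if "p \<in> P - delete_verts P e" for p
    unfolding h_def by (rule someI_ex) (use that in auto)
  have "inj_on h (P - delete_verts P e)"
  proof (rule inj_onI)
    fix p q assume "p \<in> P - delete_verts P e" "q \<in> P - delete_verts P e" "h p = h q"
    then have "p \<in> P" "q \<in> P" "h p \<in> p \<inter> q" using h[of p] h[of q] by auto
    with assms(2) show "p = q" by (auto simp: pairwise_def disjnt_def)
  qed
  moreover have "h ` (P - delete_verts P e) \<subseteq> T \<inter> e"
    using h assms(3) by blast
  ultimately have "card (P - delete_verts P e) \<le> card (T \<inter> e)"
    using assms(4) by (intro card_inj_on_le) auto
  moreover have "card P = card (delete_verts P e) + card (P - delete_verts P e)"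
    using assms(1) by (metis card_Diff_subset card_mono delete_verts_subset
        finite_delete_verts le_add_diff_inverse)
  ultimately show ?thesis by simp
qed

text \<open>Each move adds 2 to twice the value, so it should lower
  \<open>2 * card T - card P\<close> by 2. Max's move may fall short by 1 while \<open>P\<close> is
  nonempty, hence the extra 1; Min's move in \<open>P\<close> lowers it by 3 and makes up for
  that.\<close>

lemma game_matching_cover_bound:
  assumes "finite F" "\<forall>e\<in>F. card e = 2" "finite T" "\<forall>e\<in>F. e \<inter> T \<noteq> {}"
    and "P \<subseteq> F" "pairwise disjnt P" "\<Union>P \<subseteq> T"
  shows "2 * game_matching_min_first F + card P \<le> 2 * card T \<and>
         2 * game_matching_max_first F + card P \<le> 2 * card T + (if P = {} then 0 else 1)"
  using assms
proof (induction "card F" arbitrary: F P T rule: less_induct)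
  case less
  show ?case
  proof (cases "F = {}")
    case True
    with less.prems show ?thesis by simp
  next
    case False
    have F: "finite F" "{} \<notin> F" "F \<noteq> {}"
      using less.prems False by auto
    have finP: "finite P" using less.prems finite_subset by blast
    have cardT: "card T = card (T - e) + card (T \<inter> e)" for e
      using less.prems(3) by (simp add: card_Diff_subset_Int card_mono)
    have IH: "2 * game_matching_min_first (delete_verts F e) + card (delete_verts P e) \<le> 2 * card (T - e)"
      "2 * game_matching_max_first (delete_verts F e) + card (delete_verts P e)
         \<le> 2 * card (T - e) + (if delete_verts P e = {} then 0 else 1)"
      if e: "e \<in> F" for e
    proof -
      have "card (delete_verts F e) < card F"
        using e F by (intro card_delete_verts_less) auto
      moreover have "pairwise disjnt (delete_verts P e)"
        using less.prems(6) delete_verts_subset by (rule pairwise_subset)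
      moreover have "delete_verts P e \<subseteq> delete_verts F e" "\<Union>(delete_verts P e) \<subseteq> T - e"
        "\<forall>g\<in>delete_verts F e. g \<inter> (T - e) \<noteq> {}"
        using less.prems by fastforce+
      ultimately show
        "2 * game_matching_min_first (delete_verts F e) + card (delete_verts P e) \<le> 2 * card (T - e)"
        "2 * game_matching_max_first (delete_verts F e) + card (delete_verts P e)
           \<le> 2 * card (T - e) + (if delete_verts P e = {} then 0 else 1)"
        using less.hyps[of "delete_verts F e" "T - e" "delete_verts P e"] less.prems by simp_all
    qed
    have hit: "card (T \<inter> e) \<ge> 1" if "e \<in> F" for e
      using that less.prems(3,4) by (auto simp: Suc_le_eq card_gt_0_iff)
    have loss: "card P \<le> card (delete_verts P e) + card (T \<inter> e)" for e
      using card_le_delete_verts_add finP less.prems by blast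
    obtain e where e: "e \<in> F"
      "game_matching_max_first F = Suc (game_matching_min_first (delete_verts F e))"
      using game_matching_max_first_attained[OF F] by blast
    \<comment> \<open>With \<open>t = card (T \<inter> e) \<ge> 1\<close>, the potential drops by at
      least \<open>2 * t - t \<ge> 1\<close>, and by \<open>2 * t \<ge> 2\<close> if
      \<open>P\<close> is empty.\<close>
    have max: "2 * game_matching_max_first F + card P \<le> 2 * card T + (if P = {} then 0 else 1)"
      using e IH(1)[OF e(1)] hit[OF e(1)] loss[of e] cardT[of e] by (cases "P = {}") auto
    have "2 * game_matching_min_first F + card P \<le> 2 * card T"
    proof (cases "P = {}")
      case True
      \<comment> \<open>Any edge will do: it meets the cover, and the extra 1 is absent from the
        bound for Max.\<close>
      obtain e where e: "e \<in> F" using F by blast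
      have "delete_verts P e = {}" using True by auto
      with True show ?thesis
        using game_matching_min_first_le[OF F e] IH(2)[OF e] hit[OF e] cardT[of e] by simp
    next
      case False
      then obtain p where p: "p \<in> P" "p \<in> F" using less.prems by blast
      have "T \<inter> p = p" using p less.prems by blast
      then have Tp: "card (T \<inter> p) = 2" using p less.prems by simp
      \<comment> \<open>Playing \<open>p\<close> costs \<open>P\<close> only \<open>p\<close>
        itself, while \<open>T\<close> loses both ends: a drop of 4 - 1 = 3.\<close>
      have "delete_verts P p = P - {p}"
        using p less.prems(6) F by (auto simp: pairwise_def disjnt_def delete_verts_def)
      then have "card P = Suc (card (delete_verts P p))"
        using p finP by (metis card.remove)
      with Tp show ?thesis
        using game_matching_min_first_le[OF F p(2)] IH(2)[OF p(2)] cardT[of p]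
        by (auto split: if_splits)
    qed
    with max show ?thesis by simp
  qed
qed

section \<open>Smallest maximal matchings and the final bounds\<close>

lemma min_maximal_matching_attained:
  assumes "finite E"
  obtains M where "maximal_matching E M" "card M = min_maximal_matching E"
proof -
  have sub: "{M. matching E M} \<subseteq> Pow E" by (auto simp: matching_def)
  have fin: "finite {M. matching E M}"
    using finite_subset[OF sub] assms by simp
  \<comment> \<open>This makes the finite family of matchings nonempty, so it has an
    inclusion-maximal member and \<open>Min\<close> is taken over a nonempty set.\<close>
  have "matching E {}" by (simp add: matching_def)
  then have "{M. matching E M} \<noteq> {}" by blast
  then obtain M where "maximal_matching E M"
    using finite_has_maximal[OF fin] by (auto simp: maximal_matching_def)
  moreover have "finite {M. maximal_matching E M}"
    by (rule finite_subset[OF _ fin]) (auto simp: maximal_matching_def)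
  ultimately have "min_maximal_matching E \<in> card ` {M. maximal_matching E M}"
    unfolding min_maximal_matching_def by (intro Min_in) auto
  with that show ?thesis by auto
qed

theorem theorem3p5:
  fixes V :: "'a set" and E :: "'a set set"
  assumes "simple_graph V E"
  shows "real (game_matching_max_first E) - 1 \<le> real (game_matching_min_first E) \<and>
         real (game_matching_min_first E) \<le> 3 / 2 * real (min_maximal_matching E)"
proof -
  have "E \<subseteq> Pow V" "finite V" and E2: "\<forall>e\<in>E. card e = 2"
    using assms by (auto simp: simple_graph_def)
  then have finE: "finite E" by (meson finite_Pow_iff finite_subset)
  obtain M where M: "maximal_matching E M" "card M = min_maximal_matching E"
    using min_maximal_matching_attained[OF finE] .
  have ME: "M \<subseteq> E" "pairwise disjnt M" "matching E M"
    using M by (auto simp: maximal_matching_def matching_def)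
  have finM: "finite M" using ME finE finite_subset by blast
  have "{} \<notin> E" using E2 by auto
  then have "delete_verts E (\<Union>M) = {}"
    using M ME moves_empty_iff_maximal moves_eq_delete_verts by metis
  \<comment> \<open>Maximality of \<open>M\<close> says exactly that its vertices form a vertex
    cover.\<close>
  then have cover: "\<forall>e\<in>E. e \<inter> \<Union>M \<noteq> {}"
    by (auto simp: delete_verts_def)
  have "finite (\<Union>M)"
    using finM ME E2 by (metis card.infinite finite_Union subsetD zero_neq_numeral)
  \<comment> \<open>The bound is used with \<open>T = \<Union>M\<close> and \<open>P = M\<close>;
    the initial potential is then at most \<open>4 * card M - card M\<close>.\<close>
  then have "2 * game_matching_min_first E + card M \<le> 2 * card (\<Union>M)"
    using game_matching_cover_bound[OF finE E2 _ cover ME(1,2)] by blast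
  also have "card (\<Union>M) \<le> (\<Sum>e\<in>M. card e)"
    using finM by (simp add: card_Union_le_sum_card)
  also have "(\<Sum>e\<in>M. card e) = 2 * card M"
    using ME E2 by (simp add: subset_iff)
  finally have "2 * game_matching_min_first E \<le> 3 * card M" by simp
  then have "real (2 * game_matching_min_first E) \<le> real (3 * card M)"
    by (rule of_nat_mono)
  then show ?thesis
    using game_matching_max_first_le_Suc_min_first[OF finE E2] M(2) by simp
qed

end
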